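(* Fix an integer $m\ge2$. Let $\mathcal T_n$ be the largest number of vertices of a recursive tree contained in $G_m^n$. Then (i) $\liminf_{n\to\infty}\mathbb P(\mathcal T_n=n)>0$, i.e. with probability bounded away from $0$ the graph $G_m^n$ contains a spanning recursive tree; (ii) with high probability $\mathcal T_n$ is of order $n$, in the following sense: for every integer-valued $\omega=\omega(n)\to\infty$ (however slowly) with $\omega=o(n)$, with probability tending to $1$ as $n\to\infty$ one has $\mathcal T_n\ge(1-o(1))\frac{n}{\omega}$.
   Context: The Bollobás–Riordan preferential attachment multigraph $G_m^n$: $G_1^1$ is a single vertex $1$ with a loop (a loop contributes $2$ to the degree); given $G_1^{t-1}$ on $[t-1]$, vertex $t$ is added together with one edge, which joins $t$ to $s\in[t-1]$ with probability $\deg_{G_1^{t-1}}(s)/(2t-1)$ and is a loop at $t$ with probability $1/(2t-1)$. $G_m^n$ is obtained from $G_1^{mn}$ by merging vertices $m(j-1)+1,\dots,mj$ into a single vertex $j$, $j=1,\dots,n$ (keeping multiple edges and loops). A recursive tree in $G_m^n$ is a subgraph that is a tree rooted at its smallest vertex such that vertex labels increase along every path going away from the root. *)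

theory Defs
  imports "HOL-Probability.Probability" "HOL-Library.Uprod" "HOL-Library.Landau_Symbols"
begin

record mgraph =
  mverts :: "nat set"
  medges :: "nat uprod multiset"

definition wf_mgraph :: "mgraph \<Rightarrow> bool" where
  "wf_mgraph G \<longleftrightarrow> finite (mverts G) \<and> (\<forall>e \<in># medges G. set_uprod e \<subseteq> mverts G)"

text \<open>The second summand makes every loop contribute 2.\<close>

definition mdeg :: "mgraph \<Rightarrow> nat \<Rightarrow> nat" where
  "mdeg G v = size {#e \<in># medges G. v \<in> set_uprod e#} + count (medges G) (Upair v v)"

definition msubgraph :: "mgraph \<Rightarrow> mgraph \<Rightarrow> bool" where
  "msubgraph H G \<longleftrightarrow> wf_mgraph H \<and> mverts H \<subseteq> mverts G \<and> medges H \<subseteq># medges G"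

definition mpath :: "mgraph \<Rightarrow> nat list \<Rightarrow> bool" where
  "mpath G p \<longleftrightarrow> p \<noteq> [] \<and> set p \<subseteq> mverts G \<and> distinct p \<and>
     successively (\<lambda>u v. Upair u v \<in># medges G) p"

definition mconnected :: "mgraph \<Rightarrow> bool" where
  "mconnected G \<longleftrightarrow> mverts G \<noteq> {} \<and>
     (\<forall>u \<in> mverts G. \<forall>v \<in> mverts G. \<exists>p. mpath G p \<and> hd p = u \<and> last p = v)"

text \<open>
  The list \<open>c = [v\<^sub>1, \<dots>, v\<^sub>k]\<close> of distinct vertices is a cycle if the edges
  \<open>v\<^sub>1v\<^sub>2, \<dots>, v\<^sub>kv\<^sub>1\<close>, counted with multiplicity, all belong to \<open>G\<close>. Thus a loop is a cycle
  with \<open>k = 1\<close>, and a pair of parallel edges is a cycle with \<open>k = 2\<close> (but a single edge is not).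
\<close>

definition mcycle :: "mgraph \<Rightarrow> nat list \<Rightarrow> bool" where
  "mcycle G c \<longleftrightarrow> c \<noteq> [] \<and> distinct c \<and> mset (map2 Upair c (rotate1 c)) \<subseteq># medges G"

definition mtree :: "mgraph \<Rightarrow> bool" where
  "mtree T \<longleftrightarrow> wf_mgraph T \<and> mconnected T \<and> (\<nexists>c. mcycle T c)"

definition recursive_tree :: "mgraph \<Rightarrow> bool" where
  "recursive_tree T \<longleftrightarrow> mtree T \<and>
     (\<forall>p. mpath T p \<and> hd p = Min (mverts T) \<longrightarrow> sorted_wrt (<) p)"

definition max_recursive_tree :: "mgraph \<Rightarrow> nat" where
  "max_recursive_tree G = Max {card (mverts T) | T. msubgraph T G \<and> recursive_tree T}"

definition attach_weight :: "mgraph \<Rightarrow> nat \<Rightarrow> nat \<Rightarrow> real" where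
  "attach_weight G t s =
     (if s \<in> {1..<t} then real (mdeg G s) / (2 * real t - 1)
      else if s = t then 1 / (2 * real t - 1)
      else 0)"

text \<open>
  These weights form a probability mass function whenever \<open>G\<close> is a possible state of the
  process, see \<open>pmf_attach\<close> below.
\<close>

definition attach :: "mgraph \<Rightarrow> nat \<Rightarrow> nat pmf" where
  "attach G t = embed_pmf (attach_weight G t)"

definition add_vertex :: "mgraph \<Rightarrow> nat \<Rightarrow> nat \<Rightarrow> mgraph" where
  "add_vertex G t s = \<lparr>mverts = insert t (mverts G), medges = add_mset (Upair t s) (medges G)\<rparr>"

text \<open>\<open>PA1 t\<close> is the law of \<open>G\<^sub>1\<^sup>t\<close>; the process starts at \<open>t = 1\<close>, the empty graph at
  \<open>t = 0\<close> is a convention.\<close>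

fun PA1 :: "nat \<Rightarrow> mgraph pmf" where
  "PA1 0 = return_pmf \<lparr>mverts = {}, medges = {#}\<rparr>"
| "PA1 (Suc 0) = return_pmf \<lparr>mverts = {1}, medges = {#Upair 1 1#}\<rparr>"
| "PA1 (Suc (Suc t)) =
     bind_pmf (PA1 (Suc t)) (\<lambda>G. map_pmf (add_vertex G (Suc (Suc t))) (attach G (Suc (Suc t))))"

text \<open>\<open>block m\<close> sends \<open>m(j-1)+1, \<dots>, mj\<close> to \<open>j\<close>.\<close>

definition block :: "nat \<Rightarrow> nat \<Rightarrow> nat" where
  "block m v = (v - 1) div m + 1"

definition merge_blocks :: "nat \<Rightarrow> mgraph \<Rightarrow> mgraph" where
  "merge_blocks m G = \<lparr>mverts = block m ` mverts G,
     medges = image_mset (map_uprod (block m)) (medges G)\<rparr>"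

definition PA :: "nat \<Rightarrow> nat \<Rightarrow> mgraph pmf" where
  "PA m n = map_pmf (merge_blocks m) (PA1 (m * n))"

lemma block_eq_iff:
  assumes "m > 0" "v > 0" "j > 0"
  shows "block m v = j \<longleftrightarrow> v \<in> {m * (j - 1) + 1..m * j}"
proof -
  obtain w where w: "v = Suc w" using assms by (cases v) auto
  obtain i where i: "j = Suc i" using assms by (cases j) auto
  have "w div m = i \<longleftrightarrow> m * i \<le> w \<and> w < m * i + m"
    using assms(1) by (metis div_nat_eqI dividend_less_times_div mult.commute mult_Suc_right
        add.commute times_div_less_eq_dividend)
  then show ?thesis by (auto simp: block_def w i)
qed

lemma sum_mdeg:
  assumes "wf_mgraph G"
  shows "(\<Sum>v\<in>mverts G. mdeg G v) = 2 * size (medges G)"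
proof -
  have fin: "finite V" if "V = mverts G" for V
    using assms that by (simp add: wf_mgraph_def)
  have "(\<Sum>v\<in>mverts G. size {#e \<in># E. v \<in> set_uprod e#} + count E (Upair v v)) = 2 * size E"
    if "\<forall>e \<in># E. set_uprod e \<subseteq> mverts G" for E
    using that
  proof (induction E)
    case (add e E)
    obtain a b where e: "e = Upair a b" by (cases e)
    have ab: "a \<in> mverts G" "b \<in> mverts G" using add.prems e by auto
    have "(\<Sum>v\<in>mverts G. size {#e' \<in># add_mset e E. v \<in> set_uprod e'#}
             + count (add_mset e E) (Upair v v))
        = (\<Sum>v\<in>mverts G. (size {#e \<in># E. v \<in> set_uprod e#} + count E (Upair v v))
             + ((if v = a then 1 else 0) + (if v = b then 1 else 0)))"
      by (rule sum.cong) (auto simp: e)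
    also have "\<dots> = 2 * size E + 2"
      using add ab fin[OF refl] by (simp add: sum.distrib)
    finally show ?case by simp
  qed simp
  then show ?thesis using assms by (simp add: mdeg_def wf_mgraph_def)
qed

lemma pmf_attach_aux:
  assumes "wf_mgraph G" "mverts G = {1..t}" "size (medges G) = t"
  shows "pmf (attach G (Suc t)) s = attach_weight G (Suc t) s"
  unfolding attach_def
proof (rule pmf_embed_pmf)
  show nn: "0 \<le> attach_weight G (Suc t) x" for x by (simp add: attach_weight_def)
  have "(\<integral>\<^sup>+ x. ennreal (attach_weight G (Suc t) x) \<partial>count_space UNIV)
      = (\<Sum>x\<in>{1..Suc t}. ennreal (attach_weight G (Suc t) x))"
    by (rule nn_integral_count_space') (auto simp: attach_weight_def)
  also have "\<dots> = ennreal (\<Sum>x\<in>{1..Suc t}. attach_weight G (Suc t) x)"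
    using nn by (intro sum_ennreal) auto
  also have "(\<Sum>x\<in>{1..Suc t}. attach_weight G (Suc t) x)
      = (\<Sum>x\<in>{1..t}. real (mdeg G x) / (2 * real t + 1)) + 1 / (2 * real t + 1)"
    by (simp add: attach_weight_def add.commute)
  also have "(\<Sum>x\<in>{1..t}. real (mdeg G x) / (2 * real t + 1)) = 2 * real t / (2 * real t + 1)"
    using sum_mdeg[OF assms(1)] assms(2,3)
    by (simp flip: sum_divide_distrib of_nat_sum)
  also have "2 * real t / (2 * real t + 1) + 1 / (2 * real t + 1) = 1"
    by (simp add: field_simps)
  finally show "(\<integral>\<^sup>+ x. ennreal (attach_weight G (Suc t) x) \<partial>count_space UNIV) = 1" by simp
qed

lemma PA1_support:
  assumes "G \<in> set_pmf (PA1 t)"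
  shows "wf_mgraph G \<and> mverts G = {1..t} \<and> size (medges G) = t"
  using assms
proof (induction t arbitrary: G rule: PA1.induct)
  case (3 t)
  then obtain H s where H: "H \<in> set_pmf (PA1 (Suc t))"
    and s: "s \<in> set_pmf (attach H (Suc (Suc t)))" and G: "G = add_vertex H (Suc (Suc t)) s"
    by auto
  have inv: "wf_mgraph H" "mverts H = {1..Suc t}" "size (medges H) = Suc t"
    using "3.IH"[OF H] by auto
  have "s \<in> {1..Suc (Suc t)}"
    using s pmf_attach_aux[OF inv, of s]
    by (auto simp: set_pmf_eq attach_weight_def split: if_splits)
  with inv show ?case
    by (auto simp: G add_vertex_def wf_mgraph_def)
qed (auto simp: wf_mgraph_def)

lemma pmf_attach:
  assumes "G \<in> set_pmf (PA1 t)"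
  shows "pmf (attach G (Suc t)) s = attach_weight G (Suc t) s"
  using PA1_support[OF assms] by (intro pmf_attach_aux) auto

end

theory Submission
  imports Defs
begin

text \<open>
  Call a vertex a root if it has no edge to a smaller vertex. Joining every other vertex to a smaller
  neighbour decomposes the graph into recursive trees, one for each root, so
  \<open>n \<le> (number of roots) \<cdot> T\<^sub>n\<close>. Vertex \<open>j \<ge> 2\<close> can be a root only if, with \<open>t = m(j-1)+1\<close>, the edge
  of \<open>t\<close> is a loop and the edge of \<open>t+1\<close> ends in \<open>{t, t+1}\<close>. Since \<open>t\<close> then has degree \<open>2\<close>, this has
  probability \<open>1/(2t-1) \<cdot> 3/(2t+1)\<close>, which is summable: the mean number of roots other than \<open>1\<close> is at
  most \<open>1/4\<close>. By Markov's inequality there are more than \<open>k\<close> roots with probability at most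
  \<open>1/(4k)\<close>. Take \<open>k = 1\<close> for the first claim and \<open>k = \<omega>(n)\<close> for the second (with \<open>\<epsilon> = 0\<close>).
\<close>

section \<open>Trees given by a decreasing parent map\<close>

text \<open>A submultiset of a set has no repetitions. This later turns the size of a multiset of
  edges into the number of their distinct upper ends.\<close>

lemma mset_set_set_mset_if_subset:
  assumes "M \<subseteq># mset_set A"
  shows "M = mset_set (set_mset M)"
proof (rule multiset_eqI)
  fix x
  have "count M x \<le> 1"
    using mset_subset_eq_count[OF assms, of x] by (simp add: count_mset_set' split: if_splits)
  then show "count M x = count (mset_set (set_mset M)) x"
    by (auto simp: count_mset_set' not_in_iff intro: le_antisym)
qed

text \<open>One component of the forest: following \<open>f\<close> downwards strictly decreases and
  stays in \<open>S\<close>, so it must end in \<open>r\<close>.\<close>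

locale parent_map =
  fixes S :: "nat set" and r :: nat and f :: "nat \<Rightarrow> nat"
  assumes fin: "finite S" and root_in: "r \<in> S"
    and parent_in: "\<And>v. v \<in> S \<Longrightarrow> v \<noteq> r \<Longrightarrow> f v \<in> S"
    and parent_less: "\<And>v. v \<in> S \<Longrightarrow> v \<noteq> r \<Longrightarrow> f v < v"
begin

definition tree :: mgraph where
  "tree = \<lparr>mverts = S, medges = image_mset (\<lambda>v. Upair (f v) v) (mset_set (S - {r}))\<rparr>"

lemma mverts_tree [simp]: "mverts tree = S"
  by (simp add: tree_def)

lemma edge_tree_iff: "e \<in># medges tree \<longleftrightarrow> (\<exists>v\<in>S - {r}. e = Upair (f v) v)"
  using fin by (auto simp: tree_def)

text \<open>Each edge is created by its larger end, so a vertex has only one edge going down, the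
  one to its parent.\<close>

lemma edge_downD:
  assumes "Upair u v \<in># medges tree" "u < v"
  shows "u = f v"
proof -
  obtain w where w: "w \<in> S - {r}" "Upair u v = Upair (f w) w"
    using assms(1) by (auto simp: edge_tree_iff)
  with parent_less[of w] assms(2) show ?thesis by (auto simp: Upair_inject)
qed

lemma edge_tree_not_loop: "Upair u u \<notin># medges tree"
proof
  assume "Upair u u \<in># medges tree"
  then obtain w where "w \<in> S - {r}" "Upair u u = Upair (f w) w"
    unfolding edge_tree_iff by blast
  with parent_less[of w] show False by (auto simp: Upair_inject)
qed

lemma wf_tree: "wf_mgraph tree"
  using fin by (auto simp: wf_mgraph_def edge_tree_iff) (use parent_in in blast)

text \<open>A minimum other than \<open>r\<close> would have a still smaller parent in
  \<open>S\<close>. This matches \<open>r\<close> with the root required by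
  \<open>recursive_tree\<close>.\<close>

lemma root_eq_Min: "r = Min S"
proof (rule ccontr)
  assume "r \<noteq> Min S"
  moreover have "Min S \<in> S" using fin root_in by (intro Min_in) auto
  ultimately have "f (Min S) \<in> S" "f (Min S) < Min S" using parent_in parent_less by auto
  with fin show False by (meson Min_le leD)
qed

text \<open>The larger end is replaced by its parent, which lowers \<open>u + v\<close>. The bound
  by \<open>max u v\<close> is carried along because it keeps the path from the induction hypothesis
  strictly below the larger end, which can therefore be attached without repeating a vertex.\<close>

lemma tree_path:
  assumes "u \<in> S" "v \<in> S"
  shows "\<exists>p. mpath tree p \<and> hd p = u \<and> last p = v \<and> set p \<subseteq> {..max u v}"
  using assms
proof (induction "u + v" arbitrary: u v rule: less_induct)
  case less
  have ge: "r \<le> w" if "w \<in> S" for w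
    using fin that by (simp add: root_eq_Min)
  consider "u = v" | "v < u" | "u < v" by linarith
  then show ?case
  proof cases
    case 1
    with less.prems show ?thesis by (intro exI[of _ "[u]"]) (auto simp: mpath_def)
  next
    case 2
    with ge less.prems have ur: "u \<noteq> r" by fastforce
    then obtain p where p: "mpath tree p" "hd p = f u" "last p = v" "set p \<subseteq> {..max (f u) v}"
      using less.hyps[of "f u" v] parent_in[of u] parent_less[of u] less.prems by auto
    have "Upair u (f u) \<in># medges tree"
      using ur less.prems by (auto simp: edge_tree_iff Upair_inject)
    moreover have "set p \<subseteq> {..<u}" using p(4) 2 parent_less[of u] ur less.prems by fastforce
    ultimately have "mpath tree (u # p)" "set (u # p) \<subseteq> {..max u v}"
      using p less.prems by (auto simp: mpath_def successively_Cons)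
    then show ?thesis using p by (intro exI[of _ "u # p"]) (auto simp: mpath_def)
  next
    case 3
    with ge less.prems have vr: "v \<noteq> r" by fastforce
    then obtain p where p: "mpath tree p" "hd p = u" "last p = f v" "set p \<subseteq> {..max u (f v)}"
      using less.hyps[of u "f v"] parent_in[of v] parent_less[of v] less.prems by auto
    have "Upair (f v) v \<in># medges tree"
      using vr less.prems by (auto simp: edge_tree_iff)
    moreover have "set p \<subseteq> {..<v}" using p(4) 3 parent_less[of v] vr less.prems by fastforce
    ultimately have "mpath tree (p @ [v])" "set (p @ [v]) \<subseteq> {..max u v}"
      using p less.prems by (auto simp: mpath_def successively_append_iff)
    then show ?thesis using p by (intro exI[of _ "p @ [v]"]) (auto simp: mpath_def)
  qed
qed

lemma connected_tree: "mconnected tree"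
  using tree_path root_in unfolding mconnected_def by fastforce

text \<open>Distinct edges of the tree have distinct upper ends, so the upper ends of the edges of a
  cycle would exhaust its vertices, including the smallest one.\<close>

lemma acyclic_tree: "\<not> mcycle tree c"
proof
  assume c: "mcycle tree c"
  define E where "E = mset (map2 Upair c (rotate1 c))"
  define upper where "upper e = Max (set_uprod e)" for e :: "nat uprod"
  have sub: "E \<subseteq># medges tree" and ne: "c \<noteq> []" and dist: "distinct c"
    using c by (auto simp: mcycle_def E_def)
  have E_set: "set_uprod e \<subseteq> set c" if "e \<in># E" for e
    using that by (auto simp: E_def) (metis set_zip_leftD set_zip_rightD set_rotate1)+
  have "upper (Upair (f v) v) = v" if "v \<in> S - {r}" for v
    using parent_less[of v] that by (simp add: upper_def max_def)
  then have "image_mset upper (medges tree) = image_mset (\<lambda>v. v) (mset_set (S - {r}))"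
    unfolding tree_def mgraph.simps multiset.map_comp
    by (intro image_mset_cong) (simp add: fin)
  then have "image_mset upper E \<subseteq># mset_set (S - {r})"
    using image_mset_subseteq_mono[OF sub, of upper] by simp
  then have "image_mset upper E = mset_set (set_mset (image_mset upper E))"
    by (rule mset_set_set_mset_if_subset)
  then have "card (set_mset (image_mset upper E)) = size E"
    by (metis size_image_mset size_mset_set)
  also have "size E = card (set c)" using dist by (simp add: E_def distinct_card)
  finally have card: "card (set_mset (image_mset upper E)) = card (set c)" .
  have "upper e \<in> set c" if "e \<in># E" for e
    using E_set[OF that] Max_in[of "set_uprod e"] by (cases e) (auto simp: upper_def max_def)
  then have "set_mset (image_mset upper E) \<subseteq> set c" by auto
  with card have all: "set_mset (image_mset upper E) = set c"
    by (intro card_subset_eq) auto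
  \<comment> \<open>An edge with upper end \<open>Min (set c)\<close> has both ends in
    \<open>set c\<close>, hence both equal to the minimum: it is a loop.\<close>
  have "Min (set c) \<in> set c" using ne by simp
  with all obtain e where e: "e \<in># E" "upper e = Min (set c)" by (metis imageE set_image_mset)
  obtain a b where ab: "e = Upair a b" by (cases e)
  have "a \<in> set c" "b \<in> set c" using E_set[OF e(1)] ab by auto
  then have "Min (set c) \<le> a" "Min (set c) \<le> b" by auto
  moreover have "max a b = Min (set c)" using e(2) by (simp add: ab upper_def)
  ultimately have "a = b" by simp
  with e(1) sub ab edge_tree_not_loop show False by (metis mset_subset_eqD)
qed

text \<open>The first step leaves the minimum, so it goes up. After a step up from
  \<open>p ! i\<close>, that vertex is the parent of \<open>p ! Suc i\<close>; a step down would
  return to the same parent, which distinctness forbids.\<close>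

lemma increasing_path:
  assumes "mpath tree p" "hd p = r"
  shows "sorted_wrt (<) p"
proof -
  have path: "set p \<subseteq> S" "distinct p" "p \<noteq> []"
    and step: "\<And>i. Suc i < length p \<Longrightarrow> Upair (p ! i) (p ! Suc i) \<in># medges tree"
    using assms(1) by (auto simp: mpath_def successively_conv_nth)
  have "p ! i < p ! Suc i" if "Suc i < length p" for i
    using that
  proof (induction i)
    case 0
    then have "p ! 0 = r" "p ! Suc 0 \<in> S" using assms(2) path by (auto simp: hd_conv_nth)
    moreover have "p ! 0 \<noteq> p ! Suc 0" using 0 path(2,3) by (simp add: nth_eq_iff_index_eq)
    ultimately show ?case using fin by (simp add: root_eq_Min le_neq_implies_less)
  next
    case (Suc i)
    then have 1: "p ! i = f (p ! Suc i)" using step[of i] by (intro edge_downD) auto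
    have "p ! Suc (Suc i) = f (p ! Suc i)" if "p ! Suc (Suc i) < p ! Suc i"
    proof (rule edge_downD[OF _ that])
      show "Upair (p ! Suc (Suc i)) (p ! Suc i) \<in># medges tree"
        using step[OF Suc.prems] by (metis Upair_inject)
    qed
    moreover have "p ! i \<noteq> p ! Suc (Suc i)" "p ! Suc i \<noteq> p ! Suc (Suc i)"
      using Suc.prems path(2) by (auto simp: nth_eq_iff_index_eq)
    ultimately show ?case using 1 by (metis linorder_neqE_nat)
  qed
  then have "successively (<) p" by (simp add: successively_conv_nth)
  then show ?thesis by (simp add: successively_conv_sorted_wrt)
qed

lemma recursive_tree: "recursive_tree tree"
  using wf_tree connected_tree acyclic_tree increasing_path
  by (simp add: recursive_tree_def mtree_def flip: root_eq_Min)

text \<open>Distinct vertices give distinct parent edges, so each edge has multiplicity one in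
  \<open>tree\<close> and a single occurrence in \<open>G\<close> suffices.\<close>

lemma tree_msubgraph:
  assumes "S \<subseteq> mverts G" "\<And>v. v \<in> S \<Longrightarrow> v \<noteq> r \<Longrightarrow> Upair (f v) v \<in># medges G"
  shows "msubgraph tree G"
proof -
  have "inj_on (\<lambda>v. Upair (f v) v) (S - {r})"
  proof (rule inj_onI)
    fix x y assume xy: "x \<in> S - {r}" "y \<in> S - {r}" "Upair (f x) x = Upair (f y) y"
    with parent_less[of x] parent_less[of y] show "x = y" by (auto simp: Upair_inject)
  qed
  then have "medges tree = mset_set ((\<lambda>v. Upair (f v) v) ` (S - {r}))"
    by (simp add: tree_def image_mset_mset_set)
  moreover have "mset_set ((\<lambda>v. Upair (f v) v) ` (S - {r})) \<subseteq># medges G"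
    using assms(2) by (intro mset_subset_eqI) (auto simp: count_mset_set' Suc_le_eq)
  ultimately show ?thesis using wf_tree assms(1) by (simp add: msubgraph_def)
qed

end


section \<open>Largest recursive tree and number of forest roots\<close>

definition forest_roots :: "mgraph \<Rightarrow> nat set" where
  "forest_roots G = {v \<in> mverts G. \<forall>u<v. Upair u v \<notin># medges G}"

text \<open>The alternative \<open>u = v\<close> makes the set nonempty and serves as default:
  \<open>v\<close> is its own parent exactly if it has no smaller neighbour.\<close>

definition parent :: "mgraph \<Rightarrow> nat \<Rightarrow> nat" where
  "parent G v = (LEAST u. u = v \<or> Upair u v \<in># medges G)"

text \<open>The fibres of this map are the components of the forest.\<close>

function root_of :: "mgraph \<Rightarrow> nat \<Rightarrow> nat" where
  "root_of G v = (if parent G v < v then root_of G (parent G v) else v)"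
  by pat_completeness auto
termination by (relation "inv_image less_than snd") auto

declare root_of.simps [simp del]

lemma parent_le: "parent G v \<le> v"
  unfolding parent_def by (rule Least_le) simp

lemma parent_edge: "parent G v \<noteq> v \<Longrightarrow> Upair (parent G v) v \<in># medges G"
  using LeastI[of "\<lambda>u. u = v \<or> Upair u v \<in># medges G" v] by (auto simp: parent_def)

lemma parent_eq_self_imp_root:
  assumes "v \<in> mverts G" "parent G v = v"
  shows "v \<in> forest_roots G"
  using assms not_less_Least[of _ "\<lambda>u. u = v \<or> Upair u v \<in># medges G"]
  by (auto simp: forest_roots_def parent_def)

lemma parent_in_mverts: "wf_mgraph G \<Longrightarrow> v \<in> mverts G \<Longrightarrow> parent G v \<in> mverts G"
  using parent_edge[of G v] by (cases "parent G v = v") (auto simp: wf_mgraph_def)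

lemma root_of_properties:
  assumes "wf_mgraph G" "v \<in> mverts G"
  shows "root_of G v \<in> forest_roots G \<and> parent G (root_of G v) = root_of G v"
  using assms(2)
proof (induction v rule: less_induct)
  case (less v)
  show ?case
  proof (cases "parent G v < v")
    case True
    then show ?thesis
      using less parent_in_mverts[OF assms(1)] by (subst (1 2 3) root_of.simps) auto
  next
    case False
    then have "parent G v = v" using parent_le[of G v] by simp
    then show ?thesis
      using parent_eq_self_imp_root less.prems by (subst (1 2 3) root_of.simps) auto
  qed
qed

text \<open>The vertices of a contained tree are among those of \<open>G\<close>. Finiteness is what
  allows reasoning about the \<open>Max\<close> in \<open>max_recursive_tree\<close>.\<close>

lemma finite_recursive_tree_sizes:
  assumes "wf_mgraph G"
  shows "finite {card (mverts T) | T. msubgraph T G \<and> recursive_tree T}"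
    and "k \<in> {card (mverts T) | T. msubgraph T G \<and> recursive_tree T} \<Longrightarrow> k \<le> card (mverts G)"
proof -
  have *: "{card (mverts T) | T. msubgraph T G \<and> recursive_tree T} \<subseteq> {..card (mverts G)}"
    using assms by (auto simp: msubgraph_def wf_mgraph_def intro: card_mono)
  show "finite {card (mverts T) | T. msubgraph T G \<and> recursive_tree T}"
    by (rule finite_subset[OF *]) simp
  show "k \<le> card (mverts G)"
    if "k \<in> {card (mverts T) | T. msubgraph T G \<and> recursive_tree T}"
    using subsetD[OF * that] by simp
qed

text \<open>A fibre of \<open>root_of\<close> is closed under \<open>parent\<close>, and only its
  root fails to have a smaller parent. So \<open>parent_map\<close> applies and the fibre spans a
  recursive tree inside \<open>G\<close>.\<close>

lemma card_component_le:
  assumes "wf_mgraph G" "v \<in> mverts G"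
  shows "card {w \<in> mverts G. root_of G w = root_of G v} \<le> max_recursive_tree G"
proof -
  define S where "S = {w \<in> mverts G. root_of G w = root_of G v}"
  define r where "r = root_of G v"
  note r = root_of_properties[OF assms, folded r_def]
  have rr: "root_of G r = r" using r by (subst root_of.simps) simp
  have less: "parent G w < w" if "w \<in> S" "w \<noteq> r" for w
  proof (rule ccontr)
    assume "\<not> parent G w < w"
    then have "root_of G w = w" by (subst root_of.simps) simp
    then show False using that by (simp add: S_def r_def)
  qed
  interpret parent_map S r "parent G"
  proof
    show "finite S" using assms by (simp add: S_def wf_mgraph_def)
    show "r \<in> S" using r rr by (simp add: S_def forest_roots_def r_def[symmetric])
    show "parent G w < w" if "w \<in> S" "w \<noteq> r" for w by (rule less[OF that])
    show "parent G w \<in> S" if "w \<in> S" "w \<noteq> r" for w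
    proof -
      have "root_of G w = root_of G (parent G w)"
        using less[OF that] by (subst root_of.simps) simp
      then show ?thesis using that parent_in_mverts[OF assms(1)] by (simp add: S_def)
    qed
  qed
  have "msubgraph tree G"
  proof (rule tree_msubgraph)
    show "Upair (parent G w) w \<in># medges G" if "w \<in> S" "w \<noteq> r" for w
      using less[OF that] by (intro parent_edge) simp
  qed (auto simp: S_def)
  with recursive_tree have "card S \<le> max_recursive_tree G"
    unfolding max_recursive_tree_def
    using finite_recursive_tree_sizes(1)[OF assms(1)]
    by (intro Max_ge CollectI exI[of _ tree]) simp_all
  then show ?thesis by (simp add: S_def)
qed

lemma card_mverts_le_roots_mult_max:
  assumes "wf_mgraph G"
  shows "card (mverts G) \<le> card (forest_roots G) * max_recursive_tree G"
proof -
  have fin: "finite (mverts G)" using assms by (simp add: wf_mgraph_def)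
  have "card (mverts G) = (\<Sum>\<rho>\<in>root_of G ` mverts G. card {w \<in> mverts G. root_of G w = \<rho>})"
    using fin by (subst card_eq_sum, subst sum.image_gen[of _ _ "root_of G"]) auto
  also have "\<dots> \<le> (\<Sum>\<rho>\<in>root_of G ` mverts G. max_recursive_tree G)"
    using card_component_le[OF assms] by (intro sum_mono) auto
  also have "\<dots> = card (root_of G ` mverts G) * max_recursive_tree G" by simp
  also have "card (root_of G ` mverts G) \<le> card (forest_roots G)"
    using fin root_of_properties[OF assms] by (intro card_mono) (auto simp: forest_roots_def)
  finally show ?thesis by simp
qed

text \<open>A single vertex is a recursive tree, so the set under \<open>Max\<close> is nonempty and
  the bound on its elements passes to the maximum.\<close>

lemma max_recursive_tree_le_card:
  assumes "wf_mgraph G" "mverts G \<noteq> {}"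
  shows "max_recursive_tree G \<le> card (mverts G)"
proof -
  obtain v where v: "v \<in> mverts G" using assms by auto
  interpret parent_map "{v}" v id by unfold_locales auto
  have "msubgraph tree G" using v by (intro tree_msubgraph) auto
  with recursive_tree have "{card (mverts T) | T. msubgraph T G \<and> recursive_tree T} \<noteq> {}" by auto
  then show ?thesis
    unfolding max_recursive_tree_def
    using finite_recursive_tree_sizes[OF assms(1)] by (intro Max.boundedI) auto
qed


section \<open>Probability that a vertex sends no edge backwards\<close>

text \<open>One step of conditioning: \<open>B\<close> is an event of the past that \<open>A\<close>
  forces, and \<open>c\<close> bounds the chance of \<open>A\<close> given any past in
  \<open>B\<close>.\<close>

lemma prob_bind_pmf_le:
  fixes c :: real
  assumes "0 \<le> c"
    and "\<And>x. x \<in> set_pmf M \<Longrightarrow> x \<in> B \<Longrightarrow> measure_pmf.prob (f x) A \<le> c"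
    and "\<And>x. x \<in> set_pmf M \<Longrightarrow> x \<notin> B \<Longrightarrow> measure_pmf.prob (f x) A = 0"
  shows "measure_pmf.prob (bind_pmf M f) A \<le> c * measure_pmf.prob M B"
proof -
  have "emeasure (measure_pmf (bind_pmf M f)) A
      = (\<integral>\<^sup>+x. emeasure (measure_pmf (f x)) A \<partial>measure_pmf M)"
    by (rule emeasure_bind_pmf)
  also have "\<dots> \<le> (\<integral>\<^sup>+x. ennreal c * indicator B x \<partial>measure_pmf M)"
    using assms
    by (intro nn_integral_mono_AE)
      (auto simp: AE_measure_pmf_iff measure_pmf.emeasure_eq_measure ennreal_leI split: split_indicator)
  also have "\<dots> = ennreal c * emeasure (measure_pmf M) B"
    by (subst nn_integral_cmult_indicator) auto
  finally show ?thesis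
    using assms(1) by (simp add: measure_pmf.emeasure_eq_measure flip: ennreal_mult)
qed

lemma PA1_Suc:
  assumes "0 < t"
  shows "PA1 (Suc t) = bind_pmf (PA1 t) (\<lambda>G. map_pmf (add_vertex G (Suc t)) (attach G (Suc t)))"
  using assms by (cases t) auto

text \<open>The threshold \<open>t\<close> is separate from \<open>v\<close> because the second
  vertex of a block may attach to the first one and still send no edge to an earlier block.\<close>

definition no_back_edge :: "nat \<Rightarrow> nat \<Rightarrow> mgraph set" where
  "no_back_edge t v = {G. \<forall>s\<in>{1..<t}. Upair s v \<notin># medges G}"

text \<open>Avoiding all earlier vertices means choosing the loop, whose weight
  \<open>1 / (2 * (t + 1) - 1)\<close> is the same for every previous graph; hence the conditioning
  event is \<open>UNIV\<close>.\<close>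

lemma prob_first_loop:
  assumes "0 < t"
  shows "measure_pmf.prob (PA1 (Suc t)) (no_back_edge (Suc t) (Suc t)) \<le> 1 / (2 * real t + 1)"
proof -
  let ?A = "no_back_edge (Suc t) (Suc t)"
  have "measure_pmf.prob (PA1 (Suc t)) ?A \<le> 1 / (2 * real t + 1) * measure_pmf.prob (PA1 t) UNIV"
    unfolding PA1_Suc[OF assms]
  proof (rule prob_bind_pmf_le)
    fix G assume G: "G \<in> set_pmf (PA1 t)"
    have "measure_pmf.prob (attach G (Suc t)) (add_vertex G (Suc t) -` ?A)
        \<le> measure_pmf.prob (attach G (Suc t)) {Suc t}"
    proof (rule measure_pmf.finite_measure_mono_AE)
      show "AE s in measure_pmf (attach G (Suc t)).
          s \<in> add_vertex G (Suc t) -` ?A \<longrightarrow> s \<in> {Suc t}"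
        using pmf_attach[OF G]
        by (auto simp: AE_measure_pmf_iff set_pmf_eq attach_weight_def no_back_edge_def
            add_vertex_def Upair_inject split: if_splits)
    qed simp
    also have "\<dots> = 1 / (2 * real t + 1)"
      using pmf_attach[OF G] by (simp add: measure_pmf_single attach_weight_def)
    finally show "measure_pmf.prob (map_pmf (add_vertex G (Suc t)) (attach G (Suc t))) ?A
        \<le> 1 / (2 * real t + 1)"
      by simp
  qed auto
  then show ?thesis by simp
qed

text \<open>The newest vertex meets no edge but its own, and that edge is a loop, which counts
  twice.\<close>

lemma mdeg_last_loop:
  assumes "0 < t" "G \<in> set_pmf (PA1 (Suc t))" "G \<in> no_back_edge (Suc t) (Suc t)"
  shows "mdeg G (Suc t) = 2"
proof -
  obtain H s where H: "H \<in> set_pmf (PA1 t)" and s: "s \<in> set_pmf (attach H (Suc t))"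
    and G: "G = add_vertex H (Suc t) s"
    using assms(2) unfolding PA1_Suc[OF assms(1)] by auto
  have "s = Suc t"
    using s pmf_attach[OF H, of s] assms(3) G
    by (auto simp: set_pmf_eq attach_weight_def no_back_edge_def add_vertex_def Upair_inject
        split: if_splits)
  moreover have no: "Suc t \<notin> set_uprod e" if "e \<in># medges H" for e
    using PA1_support[OF H] that by (fastforce simp: wf_mgraph_def)
  moreover have "{#e \<in># medges H. Suc t \<in> set_uprod e#} = {#}"
    using no by (simp add: filter_mset_eq_conv)
  moreover have "count (medges H) (Upair (Suc t) (Suc t)) = 0"
    using no by (metis count_inI insertI1 set_uprod_simps)
  ultimately show ?thesis by (simp add: mdeg_def G add_vertex_def)
qed

text \<open>Given the loop at \<open>Suc t\<close>, the next vertex may choose \<open>Suc t\<close>,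
  of degree 2, or itself, of weight 1: together 3 out of \<open>2 * (t + 2) - 1\<close>.\<close>

lemma prob_two_internal:
  assumes "0 < t"
  shows "measure_pmf.prob (PA1 (t + 2)) (no_back_edge (Suc t) (Suc t) \<inter> no_back_edge (Suc t) (t + 2))
      \<le> 3 / ((2 * real t + 1) * (2 * real t + 3))"
proof -
  let ?B = "no_back_edge (Suc t) (Suc t)" and ?C = "no_back_edge (Suc t) (t + 2)"
  have "measure_pmf.prob (PA1 (Suc (Suc t))) (?B \<inter> ?C)
      \<le> 3 / (2 * real t + 3) * measure_pmf.prob (PA1 (Suc t)) ?B"
    unfolding PA1_Suc[OF zero_less_Suc]
  proof (rule prob_bind_pmf_le)
    fix G assume G: "G \<in> set_pmf (PA1 (Suc t))" "G \<in> ?B"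
    let ?P = "attach G (Suc (Suc t))"
    have "measure_pmf.prob ?P (add_vertex G (Suc (Suc t)) -` (?B \<inter> ?C))
        \<le> measure_pmf.prob ?P {Suc t, Suc (Suc t)}"
    proof (rule measure_pmf.finite_measure_mono_AE)
      show "AE s in measure_pmf ?P.
          s \<in> add_vertex G (Suc (Suc t)) -` (?B \<inter> ?C) \<longrightarrow> s \<in> {Suc t, Suc (Suc t)}"
        using pmf_attach[OF G(1)]
        by (auto simp: AE_measure_pmf_iff set_pmf_eq attach_weight_def no_back_edge_def
            add_vertex_def Upair_inject split: if_splits)
    qed simp
    also have "\<dots> = 3 / (2 * real t + 3)"
      using pmf_attach[OF G(1)] mdeg_last_loop[OF assms G]
      by (simp add: measure_measure_pmf_finite attach_weight_def flip: add_divide_distrib)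
    finally show "measure_pmf.prob (map_pmf (add_vertex G (Suc (Suc t))) ?P) (?B \<inter> ?C)
        \<le> 3 / (2 * real t + 3)"
      by simp
  next
    fix G assume "G \<notin> ?B"
    \<comment> \<open>A backward edge that is already present cannot be removed by adding a
      vertex.\<close>
    then have "add_vertex G (Suc (Suc t)) -` (?B \<inter> ?C) = {}"
      by (auto simp: no_back_edge_def add_vertex_def)
    then show "measure_pmf.prob (map_pmf (add_vertex G (Suc (Suc t))) (attach G (Suc (Suc t))))
        (?B \<inter> ?C) = 0"
      by simp
  qed auto
  also have "\<dots> \<le> 3 / (2 * real t + 3) * (1 / (2 * real t + 1))"
    using prob_first_loop[OF assms] by (intro mult_left_mono) auto
  finally show ?thesis by (simp add: mult.commute)
qed

text \<open>Edges are never deleted, so the event can only be lost as the graph grows. This reduces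
  the final graph to the time at which both vertices have just appeared.\<close>

lemma prob_no_back_edge_antimono:
  assumes "0 < t" "t \<le> N"
  shows "measure_pmf.prob (PA1 N) (no_back_edge s u \<inter> no_back_edge s v)
      \<le> measure_pmf.prob (PA1 t) (no_back_edge s u \<inter> no_back_edge s v)"
  using assms(2)
proof (induction N rule: dec_induct)
  case (step N)
  let ?A = "no_back_edge s u \<inter> no_back_edge s v"
  have "measure_pmf.prob (PA1 (Suc N)) ?A \<le> 1 * measure_pmf.prob (PA1 N) ?A"
    unfolding PA1_Suc[OF less_le_trans[OF assms(1) step.hyps(1)]]
  proof (rule prob_bind_pmf_le)
    fix G assume "G \<notin> ?A"
    then have "add_vertex G (Suc N) -` ?A = {}"
      by (auto simp: no_back_edge_def add_vertex_def)
    then show "measure_pmf.prob (map_pmf (add_vertex G (Suc N)) (attach G (Suc N))) ?A = 0"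
      by simp
  qed auto
  then show ?case using step.IH by simp
qed simp

section \<open>Merging blocks and the probability that a vertex is a root\<close>

lemma block_image:
  assumes "0 < m"
  shows "block m ` {1..m * n} = {1..n}"
proof (intro equalityI subsetI)
  fix j assume "j \<in> block m ` {1..m * n}"
  then obtain v where v: "j = block m v" "1 \<le> v" "v \<le> m * n" by auto
  then have "(v - 1) div m < n" using assms by (simp add: less_mult_imp_div_less mult.commute)
  then show "j \<in> {1..n}" using v by (simp add: block_def)
next
  fix j assume j: "j \<in> {1..n}"
  then have "block m (m * j) = j"
    using assms by (cases j) (auto simp: block_eq_iff)
  moreover have "m * j \<in> {1..m * n}" using j assms by auto
  ultimately show "j \<in> block m ` {1..m * n}" by (metis imageI)
qed

lemma PA_support:
  assumes "0 < m" "G \<in> set_pmf (PA m n)"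
  shows "wf_mgraph G" "mverts G = {1..n}"
proof -
  obtain H where H: "H \<in> set_pmf (PA1 (m * n))" "G = merge_blocks m H"
    using assms(2) by (auto simp: PA_def)
  note sup = PA1_support[OF H(1)]
  show "mverts G = {1..n}" using sup H block_image[OF assms(1)] by (simp add: merge_blocks_def)
  show "wf_mgraph G"
    using sup H by (fastforce simp: wf_mgraph_def merge_blocks_def uprod.set_map)
qed

lemma prob_forest_root:
  assumes "2 \<le> m" "2 \<le> j" "j \<le> n"
  shows "measure_pmf.prob (PA m n) {G. j \<in> forest_roots G}
      \<le> 3/4 * (1 / (4 * real j - 5) - 1 / (4 * real j - 1))"
proof -
  \<comment> \<open>Here \<open>t\<close> is the last vertex before block \<open>j\<close>; since
    \<open>2 \<le> m\<close>, both \<open>Suc t\<close> and \<open>t + 2\<close> lie in that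
    block.\<close>
  define t where "t = m * (j - 1)"
  have t: "2 * (j - 1) \<le> t" using assms by (simp add: t_def)
  have tj: "t + m = m * j"
    using assms by (simp add: t_def algebra_simps diff_mult_distrib2)
  then have tn: "t + 2 \<le> m * n" using assms by (metis add_left_mono le_trans mult_le_mono2)
  let ?A = "no_back_edge (Suc t) (Suc t) \<inter> no_back_edge (Suc t) (t + 2)"
  have blk: "block m (Suc t) = j" "block m (t + 2) = j"
    using assms tj by (subst block_eq_iff; auto simp: t_def)+
  have blk_less: "block m s < j" if "s \<in> {1..<Suc t}" for s
  proof -
    have "s - 1 < (j - 1) * m" using that by (auto simp: t_def mult.commute)
    then have "(s - 1) div m < j - 1" by (rule less_mult_imp_div_less)
    then show ?thesis by (simp add: block_def)
  qed
  \<comment> \<open>An edge from \<open>Suc t\<close> or \<open>t + 2\<close> to a vertex up to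
    \<open>t\<close> would become an edge from \<open>j\<close> to a smaller block.\<close>
  have "merge_blocks m -` {G. j \<in> forest_roots G} \<subseteq> ?A"
  proof (intro subsetI IntI)
    fix G assume "G \<in> merge_blocks m -` {G. j \<in> forest_roots G}"
    then have "Upair u j \<notin> map_uprod (block m) ` set_mset (medges G)" if "u < j" for u
      using that by (auto simp: forest_roots_def merge_blocks_def)
    then have *: "Upair s v \<notin># medges G" if "s \<in> {1..<Suc t}" "block m v = j" for s v
      using blk_less[OF that(1)] that(2) by (metis imageI map_uprod_simps)
    show "G \<in> no_back_edge (Suc t) (Suc t)" "G \<in> no_back_edge (Suc t) (t + 2)"
      using * blk by (auto simp: no_back_edge_def)
  qed
  then have "measure_pmf.prob (PA m n) {G. j \<in> forest_roots G} \<le> measure_pmf.prob (PA1 (m * n)) ?A"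
    unfolding PA_def measure_map_pmf by (intro measure_pmf.finite_measure_mono) auto
  also have "\<dots> \<le> measure_pmf.prob (PA1 (t + 2)) ?A"
    using tn by (intro prob_no_back_edge_antimono) auto
  also have "\<dots> \<le> 3 / ((2 * real t + 1) * (2 * real t + 3))"
    using t assms by (intro prob_two_internal) auto
  \<comment> \<open>From \<open>2 * (j - 1) \<le> t\<close> the factors are at least
    \<open>4 * j - 3\<close> and \<open>4 * j - 1\<close>. Lowering the first to
    \<open>4 * j - 5\<close> makes them consecutive values of \<open>4 * j - 1\<close>, so that the
    partial fractions telescope.\<close>
  also have "\<dots> \<le> 3 / ((4 * real j - 5) * (4 * real j - 1))"
  proof -
    have "real (2 * (j - 1)) \<le> real t" using t by (rule of_nat_mono)
    then have "2 * (real j - 1) \<le> real t" using assms by (simp add: of_nat_diff)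
    moreover have "2 \<le> real j" using assms by simp
    ultimately show ?thesis by (intro divide_left_mono mult_mono mult_pos_pos) auto
  qed
  also have "\<dots> = 3/4 * (1 / (4 * real j - 5) - 1 / (4 * real j - 1))"
  proof -
    have "2 \<le> real j" using assms by simp
    then show ?thesis by (simp add: field_simps)
  qed
  finally show ?thesis .
qed

section \<open>The mean number of roots and Markov's inequality\<close>

lemma sum_prob_forest_root:
  assumes "2 \<le> m"
  shows "(\<Sum>j\<in>{2..n}. measure_pmf.prob (PA m n) {G. j \<in> forest_roots G}) \<le> 1/4"
proof (cases "n = 0")
  case False
  have "(\<Sum>j\<in>{2..n}. measure_pmf.prob (PA m n) {G. j \<in> forest_roots G})
      \<le> (\<Sum>j\<in>{2..n}. 3/4 * (1 / (4 * real j - 5) - 1 / (4 * real j - 1)))"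
    using assms by (intro sum_mono prob_forest_root) auto
  \<comment> \<open>Telescoping: the term for \<open>j = 2\<close> contributes
    \<open>1 / (4 * 2 - 5) = 1/3\<close>.\<close>
  also have "\<dots> = 3/4 * (1/3 - 1 / (4 * real n - 1))"
    using False[THEN bot_nat_0.not_eq_extremum[THEN iffD1]]
  proof (induction n rule: nat_induct_non_zero)
    case (Suc n)
    then show ?case by (simp add: algebra_simps)
  qed simp
  also have "\<dots> \<le> 1/4" using False by simp
  finally show ?thesis .
qed simp

lemma card_ge_Markov:
  fixes M :: "'a pmf" and k :: real
  assumes "finite J" "0 < k"
  shows "measure_pmf.prob M {x. k \<le> real (card {j\<in>J. x \<in> A j})}
      \<le> (\<Sum>j\<in>J. measure_pmf.prob M (A j)) / k"
proof -
  have card: "real (card {j\<in>J. x \<in> A j}) = (\<Sum>j\<in>J. indicator (A j) x)" for x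
    using assms(1) by (simp add: indicator_def sum.If_cases Int_def)
  have "measure_pmf.prob M {x \<in> space (measure_pmf M). k \<le> (\<Sum>j\<in>J. indicator (A j) x)}
      \<le> measure_pmf.expectation M (\<lambda>x. \<Sum>j\<in>J. indicator (A j) x) / k"
    using assms by (intro integral_Markov_inequality_measure[where A = "{}"])
      (auto intro!: sum_nonneg Bochner_Integration.integrable_sum simp: less_top[symmetric])
  also have "measure_pmf.expectation M (\<lambda>x. \<Sum>j\<in>J. indicator (A j) x :: real)
      = (\<Sum>j\<in>J. measure_pmf.prob M (A j))"
    by (subst Bochner_Integration.integral_sum) (auto simp: less_top[symmetric])
  finally show ?thesis by (simp add: card)
qed

text \<open>Outside the Markov event fewer than \<open>k\<close> of the vertices from 2 on are
  roots; vertex 1 brings the total to at most \<open>k\<close>. The upper bound by \<open>n\<close>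
  is included so that \<open>k = 1\<close> yields equality.\<close>

lemma prob_max_recursive_tree_ge:
  assumes "2 \<le> m" "0 < k" "0 < n"
  shows "1 - 1 / (4 * real k)
    \<le> measure_pmf.prob (PA m n) {G. n \<le> k * max_recursive_tree G \<and> max_recursive_tree G \<le> n}"
proof -
  let ?P = "measure_pmf.prob (PA m n)"
  let ?B = "{G. real k \<le> real (card {j\<in>{2..n}. G \<in> {G. j \<in> forest_roots G}})}"
  have "?P ?B \<le> (\<Sum>j\<in>{2..n}. ?P {G. j \<in> forest_roots G}) / real k"
    using assms by (intro card_ge_Markov) auto
  also have "\<dots> \<le> 1 / 4 / real k"
    using assms by (intro divide_right_mono sum_prob_forest_root) auto
  finally have "1 - 1 / (4 * real k) \<le> ?P (- ?B)"
    by (simp add: measure_pmf.prob_compl[of ?B, simplified] Compl_eq_Diff_UNIV)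
  also have "\<dots> \<le> ?P {G. n \<le> k * max_recursive_tree G \<and> max_recursive_tree G \<le> n}"
  proof (rule measure_pmf.finite_measure_mono_AE)
    have "n \<le> k * max_recursive_tree G \<and> max_recursive_tree G \<le> n"
      if G: "G \<in> set_pmf (PA m n)" "G \<in> - ?B" for G
    proof -
      have sup: "wf_mgraph G" "mverts G = {1..n}" using PA_support[OF _ G(1)] assms by auto
      have "forest_roots G \<subseteq> insert 1 {j\<in>{2..n}. j \<in> forest_roots G}"
        using sup by (auto simp: forest_roots_def)
      then have "card (forest_roots G) \<le> card (insert 1 {j\<in>{2..n}. j \<in> forest_roots G})"
        by (intro card_mono) auto
      also have "\<dots> \<le> Suc (card {j\<in>{2..n}. j \<in> forest_roots G})" by (simp add: card_insert_if)
      also have "\<dots> \<le> k" using G(2) by simp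
      finally have "card (forest_roots G) \<le> k" .
      then show ?thesis
        using card_mverts_le_roots_mult_max[OF sup(1)] max_recursive_tree_le_card[OF sup(1)]
          sup(2) assms(3)
        by (auto intro: order_trans mult_le_mono1)
    qed
    then show "AE G in measure_pmf (PA m n).
        G \<in> - ?B \<longrightarrow> G \<in> {G. n \<le> k * max_recursive_tree G \<and> max_recursive_tree G \<le> n}"
      by (auto simp: AE_measure_pmf_iff)
  qed simp
  finally show ?thesis .
qed

section \<open>The two limits, from \<open>k = 1\<close> and from
  \<open>k = \<omega> n\<close>\<close>

theorem mainTheorem10:
  fixes m :: nat
  assumes "m \<ge> 2"
  shows
    "liminf (\<lambda>n. ereal (measure_pmf.prob (PA m n) {G. max_recursive_tree G = n})) > 0 \<and>
     (\<forall>\<omega> :: nat \<Rightarrow> int.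
        filterlim \<omega> at_top sequentially \<longrightarrow>
        (\<lambda>n. real_of_int (\<omega> n)) \<in> o(\<lambda>n. real n) \<longrightarrow>
        (\<exists>\<epsilon> :: nat \<Rightarrow> real. \<epsilon> \<longlonglongrightarrow> 0 \<and>
           (\<lambda>n. measure_pmf.prob (PA m n)
                  {G. real (max_recursive_tree G) \<ge> (1 - \<epsilon> n) * (real n / real_of_int (\<omega> n))})
             \<longlonglongrightarrow> 1))"
proof (intro conjI allI impI)
  \<comment> \<open>The constant is \<open>1 - 1 / (4 * k)\<close> at \<open>k = 1\<close>.\<close>
  have "ereal (3/4) \<le> liminf (\<lambda>n. ereal (measure_pmf.prob (PA m n) {G. max_recursive_tree G = n}))"
  proof (rule Liminf_bounded)
    show "\<forall>\<^sub>F n in sequentially.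
        ereal (3/4) \<le> ereal (measure_pmf.prob (PA m n) {G. max_recursive_tree G = n})"
      using eventually_gt_at_top[of 0]
    proof eventually_elim
      case (elim n)
      have "{G. n \<le> 1 * max_recursive_tree G \<and> max_recursive_tree G \<le> n}
          = {G. max_recursive_tree G = n}"
        by auto
      with prob_max_recursive_tree_ge[OF assms, of 1 n] elim show ?case by simp
    qed
  qed
  then show "liminf (\<lambda>n. ereal (measure_pmf.prob (PA m n) {G. max_recursive_tree G = n})) > 0"
    by (rule less_le_trans[rotated]) simp
next
  fix \<omega> :: "nat \<Rightarrow> int"
  assume \<omega>: "filterlim \<omega> at_top sequentially"
  let ?p = "\<lambda>n. measure_pmf.prob (PA m n)
    {G. real (max_recursive_tree G) \<ge> (1 - 0) * (real n / real_of_int (\<omega> n))}"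
  have "?p \<longlonglongrightarrow> 1"
  proof (rule tendsto_sandwich)
    have "filterlim (\<lambda>n. 4 * real_of_int (\<omega> n)) at_top sequentially"
      using \<omega> by (intro filterlim_tendsto_pos_mult_at_top[OF tendsto_const]
          filterlim_compose[OF filterlim_real_of_int_at_top]) auto
    then have "(\<lambda>n. 1 / (4 * real_of_int (\<omega> n))) \<longlonglongrightarrow> 0"
      by (intro tendsto_divide_0[OF tendsto_const] filterlim_at_top_imp_at_infinity)
    then show "(\<lambda>n. 1 - 1 / (4 * real_of_int (\<omega> n))) \<longlonglongrightarrow> 1"
      by (auto intro: tendsto_eq_intros)
    show "\<forall>\<^sub>F n in sequentially. 1 - 1 / (4 * real_of_int (\<omega> n)) \<le> ?p n"
      using eventually_gt_at_top[of 0] filterlim_at_top[THEN iffD1, OF \<omega>, rule_format, of 1]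
    proof eventually_elim
      case (elim n)
      \<comment> \<open>Only \<open>n\<close> with \<open>1 \<le> \<omega> n\<close> are considered
        here, so the conversion to a natural number loses nothing and \<open>k\<close> is
        positive.\<close>
      define k where "k = nat (\<omega> n)"
      have k: "0 < k" "real_of_int (\<omega> n) = real k" using elim by (auto simp: k_def)
      have "1 - 1 / (4 * real k) \<le> measure_pmf.prob (PA m n)
          {G. n \<le> k * max_recursive_tree G \<and> max_recursive_tree G \<le> n}"
        using assms k elim by (intro prob_max_recursive_tree_ge) auto
      also have "\<dots> \<le> ?p n"
      proof (intro measure_pmf.finite_measure_mono subsetI)
        fix G assume "G \<in> {G. n \<le> k * max_recursive_tree G \<and> max_recursive_tree G \<le> n}"
        then have "real n \<le> real k * real (max_recursive_tree G)"
          by (simp flip: of_nat_mult)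
        then show "G \<in> {G. real (max_recursive_tree G) \<ge> (1 - 0) * (real n / real_of_int (\<omega> n))}"
          using k by (simp add: field_simps)
      qed simp
      finally show ?case by (simp add: k)
    qed
  qed (auto simp: always_eventually)
  then show "\<exists>\<epsilon> :: nat \<Rightarrow> real. \<epsilon> \<longlonglongrightarrow> 0 \<and>
      (\<lambda>n. measure_pmf.prob (PA m n)
        {G. real (max_recursive_tree G) \<ge> (1 - \<epsilon> n) * (real n / real_of_int (\<omega> n))}) \<longlonglongrightarrow> 1"
    by (intro exI[of _ "\<lambda>_. 0"]) auto
qed

end
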